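(* Let $F$ be an iterated function system on a complete metric space $M$ such that the generated semigroup $S(F)$ contains no idempotent elements. Then the link graph of $F$ is connected if and only if $F$ has exactly one end.
   Context: An iterated function system (IFS) $F$ is a nonempty finite set of contractions (Lipschitz maps with constant $<1$) of a nonempty complete metric space $M$ into itself. $S=S(F)$ is the subsemigroup, under composition, of the set of all self-maps of $M$ generated by $F$ (all finite nonempty compositions of elements of $F$). An element $U\in S$ is idempotent if $U\circ U=U$. The Cayley graph $\Gamma(S)$ has vertex set $S$ and, for each $(s,f)\in S\times F$, an (oriented) edge from $s$ to $s\circ f$. A walk is an infinite sequence of vertices in which consecutive vertices are joined by an oriented edge; without loss of generality, walks are taken to originate from the identity, i.e. a walk is a sequence $(f_1\circ\cdots\circ f_n)_{n\ge 1}$ with all $f_i\in F$. A walk is a ray if all its vertices are distinct. Two rays are equivalent if for every finite set $E\subseteq S$ they have subsequences that lie in a common path component of $\Gamma(S)\smallsetminus E$ (paths in $\Gamma(S)\smallsetminus E$ ignore edge orientation). The ends of $F$ are the equivalence classes of rays. Two generators $f,g\in F$ are linked if there exist $u,v\in S(F)$ such that $f\circ u=g\circ v$. The link graph of $F$ is the graph with vertex set $F$ and an edge between $f$ and $g$ for each linked pair $f,g$. *)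

theory Defs
  imports "HOL-Analysis.Lipschitz" "Graph_Theory.Digraph_Component"
begin

text \<open>The nonempty complete metric space \<open>M\<close> is a type of class \<^class>\<open>complete_space\<close>.\<close>

definition iterated_function_system :: "('a::complete_space \<Rightarrow> 'a) set \<Rightarrow> bool" where
  "iterated_function_system F \<longleftrightarrow>
     finite F \<and> F \<noteq> {} \<and> (\<forall>f\<in>F. \<exists>c<1. lipschitz_on c UNIV f)"

inductive_set generated_semigroup :: "('a \<Rightarrow> 'a) set \<Rightarrow> ('a \<Rightarrow> 'a) set"
  for F :: "('a \<Rightarrow> 'a) set"
where
  generator: "f \<in> F \<Longrightarrow> f \<in> generated_semigroup F"
| composition: "s \<in> generated_semigroup F \<Longrightarrow> t \<in> generated_semigroup F \<Longrightarrow>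
    s \<circ> t \<in> generated_semigroup F"

definition idempotent :: "('a \<Rightarrow> 'a) \<Rightarrow> bool" where
  "idempotent u \<longleftrightarrow> u \<circ> u = u"

definition cayley_graph ::
  "('a \<Rightarrow> 'a) set \<Rightarrow> ('a \<Rightarrow> 'a, ('a \<Rightarrow> 'a) \<times> ('a \<Rightarrow> 'a)) pre_digraph"
where
  "cayley_graph F =
     \<lparr> verts = generated_semigroup F, arcs = generated_semigroup F \<times> F,
       tail = fst, head = (\<lambda>(s, f). s \<circ> f) \<rparr>"

text \<open>\<open>prefix_composition \<phi> n\<close> is \<open>\<phi> 0 \<circ> \<dots> \<circ> \<phi> n\<close>, with \<open>n + 1\<close> factors. The identity from
  which walks originate is not listed, as it need not be a vertex of the Cayley graph.\<close>

primrec prefix_composition :: "(nat \<Rightarrow> 'a \<Rightarrow> 'a) \<Rightarrow> nat \<Rightarrow> 'a \<Rightarrow> 'a" where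
  "prefix_composition \<phi> 0 = \<phi> 0"
| "prefix_composition \<phi> (Suc n) = prefix_composition \<phi> n \<circ> \<phi> (Suc n)"

definition is_walk :: "('a \<Rightarrow> 'a) set \<Rightarrow> (nat \<Rightarrow> 'a \<Rightarrow> 'a) \<Rightarrow> bool" where
  "is_walk F w \<longleftrightarrow> (\<exists>\<phi>. (\<forall>i. \<phi> i \<in> F) \<and> w = prefix_composition \<phi>)"

definition is_ray :: "('a \<Rightarrow> 'a) set \<Rightarrow> (nat \<Rightarrow> 'a \<Rightarrow> 'a) \<Rightarrow> bool" where
  "is_ray F r \<longleftrightarrow> is_walk F r \<and> inj r"

text \<open>Path components ignore orientation: they are the vertex sets of the strongly connected
  components of the symmetrised digraph.\<close>

definition path_components :: "('a, 'b) pre_digraph \<Rightarrow> 'a set set" where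
  "path_components G = pre_digraph.sccs_verts (with_proj (mk_symmetric G))"

definition delete_vertices :: "('a, 'b) pre_digraph \<Rightarrow> 'a set \<Rightarrow> ('a, 'b) pre_digraph" where
  "delete_vertices G E = induce_subgraph G (verts G - E)"

definition rays_equivalent ::
  "('a \<Rightarrow> 'a) set \<Rightarrow> (nat \<Rightarrow> 'a \<Rightarrow> 'a) \<Rightarrow> (nat \<Rightarrow> 'a \<Rightarrow> 'a) \<Rightarrow> bool"
where
  "rays_equivalent F r r' \<longleftrightarrow>
     (\<forall>E. finite E \<and> E \<subseteq> generated_semigroup F \<longrightarrow>
       (\<exists>C \<in> path_components (delete_vertices (cayley_graph F) E).
          \<exists>\<sigma> \<tau> :: nat \<Rightarrow> nat. strict_mono \<sigma> \<and> strict_mono \<tau> \<and>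
            (\<forall>n. r (\<sigma> n) \<in> C \<and> r' (\<tau> n) \<in> C)))"

definition ends :: "('a \<Rightarrow> 'a) set \<Rightarrow> (nat \<Rightarrow> 'a \<Rightarrow> 'a) set set" where
  "ends F = Collect (is_ray F) //
     {(r, r'). is_ray F r \<and> is_ray F r' \<and> rays_equivalent F r r'}"

definition linked :: "('a \<Rightarrow> 'a) set \<Rightarrow> ('a \<Rightarrow> 'a) \<Rightarrow> ('a \<Rightarrow> 'a) \<Rightarrow> bool" where
  "linked F f g \<longleftrightarrow>
     (\<exists>u \<in> generated_semigroup F. \<exists>v \<in> generated_semigroup F. f \<circ> u = g \<circ> v)"

text \<open>As a symmetric digraph; every generator is linked to itself, and the resulting loops do not
  affect connectedness.\<close>

definition link_graph :: "('a \<Rightarrow> 'a) set \<Rightarrow> ('a \<Rightarrow> 'a) pair_pre_digraph" where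
  "link_graph F = \<lparr> pverts = F, parcs = {(f, g). f \<in> F \<and> g \<in> F \<and> linked F f g} \<rparr>"

end

theory Submission
  imports Defs
begin

text \<open>Products of many generators are strong contractions, so a map that is a product of
  arbitrarily many generators is constant, hence idempotent. Without idempotents every walk is
  therefore a ray, and every finite set of vertices misses the set of products of more than \<open>n\<close>
  generators for some \<open>n\<close>. If the link graph is connected, each of these sets is connected, by
  induction on \<open>n\<close>: it is the union of the left translates by the generators of the preceding set,
  and translates by linked generators intersect. Conversely, two first letters of the same element
  are linked and first letters persist along arcs, so the component of the first letter in the
  link graph is constant on each component of the Cayley graph.\<close>

section \<open>Long products\<close>

text \<open>The elements with some factorisation into more than \<open>n\<close> generators.
  Factorisations need not be unique, so these are sets rather than a length function. Recursion on
  the outermost factor makes each set, by definition, the union of left translates of the preceding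
  one.\<close>

primrec long_products :: "('a \<Rightarrow> 'a) set \<Rightarrow> nat \<Rightarrow> ('a \<Rightarrow> 'a) set" where
  "long_products F 0 = generated_semigroup F"
| "long_products F (Suc n) = {f \<circ> s | f s. f \<in> F \<and> s \<in> long_products F n}"

declare long_products.simps(2) [simp del]

lemma long_products_SucI: "f \<in> F \<Longrightarrow> s \<in> long_products F n \<Longrightarrow> f \<circ> s \<in> long_products F (Suc n)"
  unfolding long_products.simps by blast

lemma long_products_SucE:
  assumes "s \<in> long_products F (Suc n)"
  obtains f t where "f \<in> F" "t \<in> long_products F n" "s = f \<circ> t"
  using assms unfolding long_products.simps by blast

lemma long_products_Suc_subset: "long_products F (Suc n) \<subseteq> long_products F n"
proof (induction n)
  case 0
  show ?case
    by (auto elim!: long_products_SucE intro: generated_semigroup.intros)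
next
  case (Suc n)
  then show ?case
    by (blast elim: long_products_SucE intro: long_products_SucI)
qed

lemma long_products_antimono: "m \<le> n \<Longrightarrow> long_products F n \<subseteq> long_products F m"
  by (rule lift_Suc_antimono_le[of "long_products F"]) (rule long_products_Suc_subset)

lemma long_products_subset_semigroup: "long_products F n \<subseteq> generated_semigroup F"
  using long_products_antimono[of 0 n F] by simp

lemma comp_long_products:
  assumes "s \<in> generated_semigroup F" "t \<in> long_products F n"
  shows "s \<circ> t \<in> long_products F (Suc n)"
  using assms
proof (induction arbitrary: t)
  case (generator f)
  then show ?case by (rule long_products_SucI)
next
  case (composition s s')
  \<comment> \<open>The length gained from \<open>s'\<close> is given up again, so that the
    hypothesis for \<open>s\<close> applies at level \<open>n\<close>.\<close>
  then have "s \<circ> (s' \<circ> t) \<in> long_products F (Suc n)"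
    using long_products_Suc_subset by blast
  then show ?case by (metis comp_assoc)
qed

lemma long_products_comp:
  assumes "s \<in> long_products F n" "t \<in> generated_semigroup F"
  shows "s \<circ> t \<in> long_products F (Suc n)"
  using assms(1)
proof (induction n arbitrary: s)
  case 0
  then show ?case
    by (intro comp_long_products) (use assms(2) in simp_all)
next
  case (Suc n)
  from Suc.prems obtain f x where "f \<in> F" "x \<in> long_products F n" "s = f \<circ> x"
    by (rule long_products_SucE)
  with Suc.IH show ?case
    by (metis comp_assoc long_products_SucI)
qed

lemma prefix_composition_in_long_products:
  assumes "\<And>i. \<phi> i \<in> F"
  shows "prefix_composition \<phi> n \<in> long_products F n"
proof (induction n)
  case 0
  show ?case using assms by (simp add: generated_semigroup.generator)
next
  case (Suc n)
  then show ?case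
    unfolding prefix_composition.simps
    using assms by (intro long_products_comp generated_semigroup.generator)
qed

section \<open>Contraction estimates and the exclusion of idempotents\<close>

lemma ifs_uniform_contraction:
  assumes "iterated_function_system F"
  obtains c where "0 \<le> c" "c < 1" "\<And>f x y. f \<in> F \<Longrightarrow> dist (f x) (f y) \<le> c * dist x y"
proof -
  have fin: "finite F" "F \<noteq> {}" and "\<forall>f\<in>F. \<exists>c<1. lipschitz_on c UNIV f"
    using assms by (auto simp: iterated_function_system_def)
  then obtain k where k: "\<And>f. f \<in> F \<Longrightarrow> k f < 1 \<and> lipschitz_on (k f) UNIV f"
    by metis
  show thesis
  \<comment> \<open>The maximum over the finite set \<open>F\<close> is attained, hence still below
    1; it is nonnegative because Lipschitz constants are and \<open>F\<close> is nonempty.\<close>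
  proof
    have le: "k f \<le> Max (k ` F)" if "f \<in> F" for f
      using fin that by simp
    show "0 \<le> Max (k ` F)"
      using fin le k lipschitz_on_nonneg by (metis ex_in_conv order_trans)
    show "Max (k ` F) < 1"
      using fin k by simp
    show "dist (f x) (f y) \<le> Max (k ` F) * dist x y" if "f \<in> F" for f x y
    proof -
      have "dist (f x) (f y) \<le> k f * dist x y"
        using k[OF that] by (auto simp: lipschitz_on_def)
      also have "\<dots> \<le> Max (k ` F) * dist x y"
        using le[OF that] by (simp add: mult_right_mono)
      finally show ?thesis .
    qed
  qed
qed

lemma semigroup_nonexpansive:
  assumes "s \<in> generated_semigroup F" "c \<le> 1"
    and "\<And>f x y. f \<in> F \<Longrightarrow> dist (f x) (f y) \<le> c * dist x y"
  shows "dist (s x) (s y) \<le> dist x y"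
  using assms(1)
proof (induction arbitrary: x y)
  case (generator f)
  have "c * dist x y \<le> 1 * dist x y"
    using assms(2) by (intro mult_right_mono) auto
  then show ?case using assms(3)[OF generator, of x y] by simp
next
  case (composition s t)
  then show ?case by (metis comp_apply order_trans)
qed

text \<open>Each of the \<open>n\<close> generators peeled off contributes a factor
  \<open>c\<close>; the remaining product is only used as a nonexpansive map.\<close>

lemma long_products_contraction:
  assumes "s \<in> long_products F n" "0 \<le> c" "c \<le> 1"
    and "\<And>f x y. f \<in> F \<Longrightarrow> dist (f x) (f y) \<le> c * dist x y"
  shows "dist (s x) (s y) \<le> c ^ n * dist x y"
  using assms(1)
proof (induction n arbitrary: s)
  case 0
  then show ?case using semigroup_nonexpansive assms(3,4) by fastforce
next
  case (Suc n)
  then obtain f t where ft: "f \<in> F" "t \<in> long_products F n" "s = f \<circ> t"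
    using long_products_SucE by blast
  have "dist (s x) (s y) \<le> c * dist (t x) (t y)"
    using ft assms(4) by simp
  also have "\<dots> \<le> c * (c ^ n * dist x y)"
    using Suc.IH[OF ft(2)] assms(2) by (rule mult_left_mono)
  finally show ?case by (simp add: mult.assoc)
qed

text \<open>Contractivity and the absence of idempotents enter the argument only through this lemma:
  letting \<open>n\<close> tend to infinity in the contraction estimate makes \<open>s\<close>
  constant.\<close>

lemma ex_not_in_long_products:
  assumes "iterated_function_system F" "\<not> (\<exists>u \<in> generated_semigroup F. idempotent u)"
  shows "\<exists>n. s \<notin> long_products F n"
proof (rule ccontr)
  assume "\<nexists>n. s \<notin> long_products F n"
  then have s: "s \<in> long_products F n" for n by blast
  obtain c where c: "0 \<le> c" "c < 1" "\<And>f x y. f \<in> F \<Longrightarrow> dist (f x) (f y) \<le> c * dist x y"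
    using ifs_uniform_contraction[OF assms(1)] by blast
  have "s x = s y" for x y
  proof -
    have "(\<lambda>n. c ^ n * dist x y) \<longlonglongrightarrow> 0 * dist x y"
      using c by (intro tendsto_mult tendsto_const LIMSEQ_realpow_zero)
    moreover have "dist (s x) (s y) \<le> c ^ n * dist x y" for n
      using long_products_contraction[OF s] c by simp
    ultimately have "dist (s x) (s y) \<le> 0 * dist x y"
      by (intro LIMSEQ_le_const) auto
    then show ?thesis by simp
  qed
  then have "idempotent s"
    by (auto simp: idempotent_def fun_eq_iff)
  with s[of 0] assms(2) show False by auto
qed

text \<open>Lets the sets \<open>long_products F n\<close> stand in for complements of finite vertex
  sets. As they decrease in \<open>n\<close>, the larger of two indices avoids both parts of
  \<open>E\<close>.\<close>

lemma finite_misses_long_products: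
  assumes "iterated_function_system F" "\<not> (\<exists>u \<in> generated_semigroup F. idempotent u)"
    and "finite E"
  shows "\<exists>n. E \<inter> long_products F n = {}"
  using \<open>finite E\<close>
proof induction
  case (insert s E)
  then obtain n where n: "E \<inter> long_products F n = {}" by blast
  obtain m where m: "s \<notin> long_products F m"
    using ex_not_in_long_products[OF assms(1,2)] by blast
  have "long_products F (max m n) \<subseteq> long_products F m" "long_products F (max m n) \<subseteq> long_products F n"
    by (simp_all add: long_products_antimono)
  with n m have "insert s E \<inter> long_products F (max m n) = {}" by blast
  then show ?case by blast
qed simp

section \<open>Walks as rays\<close>

lemma prefix_composition_factor:
  assumes "\<And>i. \<phi> i \<in> F"
  shows "\<exists>t \<in> generated_semigroup F. prefix_composition \<phi> (Suc (m + n)) = prefix_composition \<phi> m \<circ> t"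
\<comment> \<open>The index \<open>Suc (m + n)\<close> guarantees a nonempty remainder, as the
  semigroup may lack the identity.\<close>
proof (induction n)
  case 0
  show ?case using generated_semigroup.generator[OF assms] by auto
next
  case (Suc n)
  then obtain t where "t \<in> generated_semigroup F"
    "prefix_composition \<phi> (Suc (m + n)) = prefix_composition \<phi> m \<circ> t" by blast
  then show ?case
    using generated_semigroup.composition[OF _ generated_semigroup.generator[OF assms]]
    by (intro bexI[of _ "t \<circ> \<phi> (Suc (Suc (m + n)))"]) (auto simp: comp_assoc)
qed

text \<open>A repeated vertex \<open>s\<close> satisfies \<open>s = s \<circ> t\<close>.
  Substituting this equation into itself gives \<open>s\<close> arbitrarily long
  factorisations.\<close>

lemma is_ray_prefix_composition:
  assumes "iterated_function_system F" "\<not> (\<exists>u \<in> generated_semigroup F. idempotent u)"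
    and \<phi>: "\<And>i. \<phi> i \<in> F"
  shows "is_ray F (prefix_composition \<phi>)"
proof -
  have "prefix_composition \<phi> m \<noteq> prefix_composition \<phi> n" if "m < n" for m n
  proof
    assume eq: "prefix_composition \<phi> m = prefix_composition \<phi> n"
    define s where "s = prefix_composition \<phi> m"
    have n: "n = Suc (m + (n - Suc m))" using that by simp
    obtain t where t: "t \<in> generated_semigroup F" "s = s \<circ> t"
      using prefix_composition_factor[of \<phi> F m "n - Suc m"] \<phi> n eq
      unfolding s_def by metis
    have "s \<in> long_products F k" for k
    proof (induction k)
      case 0
      show ?case
        using prefix_composition_in_long_products[of \<phi> F m] \<phi> long_products_subset_semigroup
        by (auto simp: s_def)
    next
      case (Suc k)
      then show ?case using long_products_comp t by metis
    qed
    then show False using ex_not_in_long_products[OF assms(1,2)] by blast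
  qed
  then have "inj (prefix_composition \<phi>)" by (rule linorder_injI)
  with \<phi> show ?thesis by (auto simp: is_ray_def is_walk_def)
qed

section \<open>Reachability\<close>

text \<open>Not confined to the semigroup: \<open>rtrancl_on\<close> supplies the vertex set, so one
  relation serves both the complement of \<open>E\<close> and the sets of long products.\<close>

definition cayley_adjacency :: "('a \<Rightarrow> 'a) set \<Rightarrow> (('a \<Rightarrow> 'a) \<times> ('a \<Rightarrow> 'a)) set" where
  "cayley_adjacency F = {(s, t). \<exists>f\<in>F. t = s \<circ> f \<or> s = t \<circ> f}"

lemma cayley_reachable_sym:
  "(s, t) \<in> rtrancl_on X (cayley_adjacency F) \<Longrightarrow> (t, s) \<in> rtrancl_on X (cayley_adjacency F)"
  by (rule symD[OF rtrancl_on_sym]) (unfold sym_def cayley_adjacency_def, blast)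

lemma reachable_delete_vertices_iff:
  "s \<rightarrow>\<^sup>*\<^bsub>with_proj (mk_symmetric (delete_vertices (cayley_graph F) E))\<^esub> t \<longleftrightarrow>
    (s, t) \<in> rtrancl_on (generated_semigroup F - E) (cayley_adjacency F)"
    (is "s \<rightarrow>\<^sup>*\<^bsub>?G\<^esub> t \<longleftrightarrow> (s, t) \<in> rtrancl_on ?V _")
proof -
  have V: "verts ?G = ?V"
    by (auto simp: delete_vertices_def cayley_graph_def)
  have A: "arcs_ends ?G = cayley_adjacency F \<inter> ?V \<times> ?V"
    by (force simp: arcs_ends_def arc_to_ends_def parcs_mk_symmetric delete_vertices_def
        cayley_graph_def cayley_adjacency_def)
  show ?thesis
    unfolding reachable_def V A
  proof
    \<comment> \<open>Paths of \<open>rtrancl_on\<close> visit only vertices of \<open>?V\<close>,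
      so every pair they use already lies in \<open>?V \<times> ?V\<close>.\<close>
    assume "(s, t) \<in> rtrancl_on ?V (cayley_adjacency F)"
    then show "(s, t) \<in> rtrancl_on ?V (cayley_adjacency F \<inter> ?V \<times> ?V)"
      by (induction rule: rtrancl_on_induct) (auto intro: rtrancl_on_into_rtrancl_on)
  qed (rule rtrancl_on_mono[OF Int_lower1 subset_refl])
qed

text \<open>Symmetry of the adjacency turns reachability from \<open>u\<close> into mutual
  reachability, so the set reached from \<open>u\<close> is a full strong component.\<close>

lemma path_componentI:
  assumes "u \<in> generated_semigroup F - E"
  shows "{v. (u, v) \<in> rtrancl_on (generated_semigroup F - E) (cayley_adjacency F)}
    \<in> path_components (delete_vertices (cayley_graph F) E)"
proof -
  let ?R = "rtrancl_on (generated_semigroup F - E) (cayley_adjacency F)"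
  have "(u, u) \<in> ?R"
    using assms by (rule rtrancl_on_refl)
  moreover have "(v, w) \<in> ?R" if "(u, v) \<in> ?R" "(u, w) \<in> ?R" for v w
    using cayley_reachable_sym[OF that(1)] that(2) by (rule rtrancl_on_trans)
  moreover have "(u, w) \<in> ?R" if "(u, v) \<in> ?R" "(v, w) \<in> ?R" for v w
    using that by (rule rtrancl_on_trans)
  ultimately show ?thesis
    unfolding path_components_def pre_digraph.sccs_verts_def reachable_delete_vertices_iff
    by blast
qed

lemma path_componentD:
  assumes "C \<in> path_components (delete_vertices (cayley_graph F) E)" "s \<in> C" "t \<in> C"
  shows "(s, t) \<in> rtrancl_on (generated_semigroup F - E) (cayley_adjacency F)"
  using assms
  unfolding path_components_def pre_digraph.sccs_verts_def reachable_delete_vertices_iff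
  by blast

lemma linked_sym: "linked F f g \<Longrightarrow> linked F g f"
  unfolding linked_def by (blast dest: sym)

lemma link_reachable_sym:
  "(f, g) \<in> rtrancl_on F {(f, g). linked F f g} \<Longrightarrow>
    (g, f) \<in> rtrancl_on F {(f, g). linked F f g}"
  by (rule symD[OF rtrancl_on_sym]) (unfold sym_def, blast intro: linked_sym)

text \<open>Linking is symmetric, so symmetrising adds no arcs. The conjunct
  \<open>F \<noteq> {}\<close> comes from the convention that strongly connected digraphs have a
  vertex.\<close>

lemma connected_link_graph_iff:
  "Digraph_Component.connected (with_proj (link_graph F)) \<longleftrightarrow>
    F \<noteq> {} \<and> (\<forall>f\<in>F. \<forall>g\<in>F. (f, g) \<in> rtrancl_on F {(f, g). linked F f g})"
proof -
  let ?G = "with_proj (mk_symmetric (with_proj (link_graph F)))"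
  have V: "verts ?G = F"
    by (auto simp: link_graph_def)
  have A: "arcs_ends ?G = {(f, g). linked F f g} \<inter> F \<times> F"
    by (force simp: arcs_ends_def arc_to_ends_def parcs_mk_symmetric link_graph_def linked_sym)
  have "(f, g) \<in> rtrancl_on F ({(f, g). linked F f g} \<inter> F \<times> F) \<longleftrightarrow>
      (f, g) \<in> rtrancl_on F {(f, g). linked F f g}" for f g
  proof
    assume "(f, g) \<in> rtrancl_on F {(f, g). linked F f g}"
    then show "(f, g) \<in> rtrancl_on F ({(f, g). linked F f g} \<inter> F \<times> F)"
      by (induction rule: rtrancl_on_induct) (auto intro: rtrancl_on_into_rtrancl_on)
  qed (rule rtrancl_on_mono[OF Int_lower1 subset_refl])
  then show ?thesis
    unfolding Digraph_Component.connected_def strongly_connected_def reachable_def V A by simp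
qed

section \<open>Connected link graphs\<close>

text \<open>Right multiplication by generators follows arcs and lengthens the product, so the path
  never leaves the set.\<close>

lemma reachable_comp_right:
  assumes "t \<in> generated_semigroup F" "s \<in> long_products F n"
  shows "(s, s \<circ> t) \<in> rtrancl_on (long_products F n) (cayley_adjacency F)"
  using assms
proof (induction arbitrary: s)
  case (generator f)
  then have "s \<circ> f \<in> long_products F n"
    using long_products_comp long_products_Suc_subset generated_semigroup.generator by blast
  moreover have "(s, s \<circ> f) \<in> cayley_adjacency F"
    unfolding cayley_adjacency_def using generator.hyps by blast
  ultimately show ?case
    using generator.prems by (metis rtrancl_on_refl rtrancl_on_into_rtrancl_on)
next
  case (composition t u)
  then have "s \<circ> t \<in> long_products F n"
    using long_products_comp long_products_Suc_subset by blast
  with composition show ?case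
    by (metis comp_assoc rtrancl_on_trans)
qed

text \<open>Arcs multiply on the right, so left translation by \<open>f\<close> preserves adjacency,
  and it raises the level by one.\<close>

lemma reachable_comp_left:
  assumes "(s, t) \<in> rtrancl_on (long_products F n) (cayley_adjacency F)" "f \<in> F"
  shows "(f \<circ> s, f \<circ> t) \<in> rtrancl_on (long_products F (Suc n)) (cayley_adjacency F)"
  using assms(1)
proof (induction rule: rtrancl_on_induct)
  case base
  then show ?case using assms(2) by (intro rtrancl_on_refl long_products_SucI)
next
  case (step y z)
  have "(f \<circ> y, f \<circ> z) \<in> cayley_adjacency F"
    using step by (auto simp: cayley_adjacency_def comp_assoc)
  moreover have "f \<circ> z \<in> long_products F (Suc n)"
    using step assms(2) by (blast intro: long_products_SucI)
  ultimately show ?case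
    using step rtrancl_on_into_rtrancl_on by metis
qed

lemma reachable_from_generator:
  assumes "s \<in> generated_semigroup F"
  shows "\<exists>f\<in>F. (f, s) \<in> rtrancl_on (generated_semigroup F) (cayley_adjacency F)"
  using assms
proof induction
  case (composition s t)
  then show ?case
    using reachable_comp_right[of t F s 0] by (metis long_products.simps(1) rtrancl_on_trans)
qed (auto intro: generated_semigroup.generator)

lemma long_products_connected:
  assumes conn: "\<forall>f\<in>F. \<forall>g\<in>F. (f, g) \<in> rtrancl_on F {(f, g). linked F f g}"
    and "s \<in> long_products F n" "t \<in> long_products F n"
  shows "(s, t) \<in> rtrancl_on (long_products F n) (cayley_adjacency F)"
  using assms(2,3)
proof (induction n arbitrary: s t)
  case 0
  let ?R = "rtrancl_on (generated_semigroup F) (cayley_adjacency F)"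
  \<comment> \<open>Linked generators \<open>g\<close> and \<open>h\<close> are joined through their
    common right multiple \<open>g \<circ> u = h \<circ> v\<close>.\<close>
  have gens: "(f, g) \<in> ?R" if "(f, g) \<in> rtrancl_on F {(f, g). linked F f g}" for f g
    using that
  proof (induction rule: rtrancl_on_induct)
    case base
    then show ?case by (simp add: generated_semigroup.generator)
  next
    case (step g h)
    then obtain u v where uv: "u \<in> generated_semigroup F" "v \<in> generated_semigroup F"
      "g \<circ> u = h \<circ> v" by (auto simp: linked_def)
    have "(k, k \<circ> w) \<in> ?R" if "k \<in> F" "w \<in> generated_semigroup F" for k w
      using reachable_comp_right[of w F k 0] that generated_semigroup.generator by auto
    with uv step.hyps have "(g, g \<circ> u) \<in> ?R" "(h, h \<circ> v) \<in> ?R"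
      by blast+
    with uv(3) step.IH show ?case
      by (metis cayley_reachable_sym rtrancl_on_trans)
  qed
  obtain f g where "f \<in> F" "g \<in> F" "(f, s) \<in> ?R" "(g, t) \<in> ?R"
    using reachable_from_generator 0 by (metis long_products.simps(1))
  with gens conn have "(s, t) \<in> ?R"
    by (metis cayley_reachable_sym rtrancl_on_trans)
  then show ?case by simp
next
  case (Suc n)
  let ?R = "rtrancl_on (long_products F (Suc n)) (cayley_adjacency F)"
  obtain f x where fx: "f \<in> F" "x \<in> long_products F n" "s = f \<circ> x"
    using Suc.prems long_products_SucE by blast
  obtain g y where gy: "g \<in> F" "y \<in> long_products F n" "t = g \<circ> y"
    using Suc.prems long_products_SucE by blast
  \<comment> \<open>All of the translate by \<open>g\<close> must be reached, since the induction
    along the link path has to leave it at a point dictated by the next link.\<close>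
  have "\<forall>z \<in> long_products F n. (f \<circ> x, g \<circ> z) \<in> ?R"
    if "(f, g) \<in> rtrancl_on F {(f, g). linked F f g}" for g
    using that
  proof (induction rule: rtrancl_on_induct)
    case base
    then show ?case using Suc.IH fx reachable_comp_left by blast
  next
    case (step g h)
    then obtain u v where uv: "u \<in> generated_semigroup F" "v \<in> generated_semigroup F"
      "g \<circ> u = h \<circ> v" by (auto simp: linked_def)
    \<comment> \<open>Multiplying the link equation on the right by \<open>x\<close> moves the
      meeting point of the two translates to the required level.\<close>
    have ux: "u \<circ> x \<in> long_products F n" and vx: "v \<circ> x \<in> long_products F n"
      using comp_long_products long_products_Suc_subset uv fx by blast+
    have "(f \<circ> x, g \<circ> (u \<circ> x)) \<in> ?R"
      using step.IH ux by blast
    moreover have "g \<circ> (u \<circ> x) = h \<circ> (v \<circ> x)"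
      using uv(3) by (simp flip: comp_assoc)
    moreover have "(h \<circ> (v \<circ> x), h \<circ> z) \<in> ?R" if "z \<in> long_products F n" for z
      using that vx Suc.IH step.hyps reachable_comp_left by blast
    ultimately show ?case
      by (metis rtrancl_on_trans)
  qed
  with conn fx gy show ?case by metis
qed

section \<open>Ends\<close>

text \<open>Replaces the deletion of an arbitrary finite set by restriction to
  \<open>long_products F N\<close>. The common base point \<open>u\<close> places both tails in one
  component.\<close>

lemma rays_equivalentI:
  assumes "iterated_function_system F" "\<not> (\<exists>u \<in> generated_semigroup F. idempotent u)"
    and tails: "\<And>N. \<exists>u. \<forall>n. (u, r (n + N)) \<in> rtrancl_on (long_products F N) (cayley_adjacency F) \<and>
      (u, r' (n + N)) \<in> rtrancl_on (long_products F N) (cayley_adjacency F)"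
  shows "rays_equivalent F r r'"
  unfolding rays_equivalent_def
proof (intro allI impI)
  fix E assume "finite E \<and> E \<subseteq> generated_semigroup F"
  then obtain N where N: "E \<inter> long_products F N = {}"
    using finite_misses_long_products[OF assms(1,2)] by blast
  then have sub: "long_products F N \<subseteq> generated_semigroup F - E"
    using long_products_subset_semigroup by blast
  obtain u where u: "\<And>n. (u, r (n + N)) \<in> rtrancl_on (long_products F N) (cayley_adjacency F)"
      "\<And>n. (u, r' (n + N)) \<in> rtrancl_on (long_products F N) (cayley_adjacency F)"
    using tails by metis
  let ?C = "{v. (u, v) \<in> rtrancl_on (generated_semigroup F - E) (cayley_adjacency F)}"
  have "u \<in> generated_semigroup F - E"
    using in_rtrancl_on_in_F(1)[OF u(1)] sub by blast
  then have "?C \<in> path_components (delete_vertices (cayley_graph F) E)"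
    by (rule path_componentI)
  moreover have "r (n + N) \<in> ?C" "r' (n + N) \<in> ?C" for n
    using rtrancl_on_mono[OF subset_refl sub] u by blast+
  moreover have "strict_mono (\<lambda>n. n + N)"
    by (auto simp: strict_mono_def)
  ultimately show "\<exists>C\<in>path_components (delete_vertices (cayley_graph F) E).
      \<exists>\<sigma> \<tau> :: nat \<Rightarrow> nat. strict_mono \<sigma> \<and> strict_mono \<tau> \<and> (\<forall>n. r (\<sigma> n) \<in> C \<and> r' (\<tau> n) \<in> C)"
    by blast
qed

lemma ray_in_long_products:
  assumes "is_ray F r"
  shows "r (n + N) \<in> long_products F N"
proof -
  \<comment> \<open>Numbering starts at 0, so vertex \<open>k\<close> of a walk has
    \<open>k + 1\<close> factors and lies at level \<open>k\<close>.\<close>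
  have "r (n + N) \<in> long_products F (n + N)"
    using assms prefix_composition_in_long_products by (auto simp: is_ray_def is_walk_def)
  moreover have "long_products F (n + N) \<subseteq> long_products F N"
    by (simp add: long_products_antimono)
  ultimately show ?thesis by blast
qed

text \<open>From index \<open>N\<close> on, consecutive vertices of the ray are adjacent and stay at
  level \<open>N\<close>, so the tail is itself a path from \<open>r N\<close>.\<close>

lemma rays_equivalent_refl:
  assumes "iterated_function_system F" "\<not> (\<exists>u \<in> generated_semigroup F. idempotent u)"
    and "is_ray F r"
  shows "rays_equivalent F r r"
proof -
  have "(r N, r (n + N)) \<in> rtrancl_on (long_products F N) (cayley_adjacency F)" for n N
  proof (induction n)
    case 0
    show ?case using ray_in_long_products[OF assms(3), of 0 N] by simp
  next
    case (Suc n)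
    obtain \<phi> where "\<And>i. \<phi> i \<in> F" "r = prefix_composition \<phi>"
      using assms(3) by (auto simp: is_ray_def is_walk_def)
    then have "(r (n + N), r (Suc n + N)) \<in> cayley_adjacency F"
      by (auto simp: cayley_adjacency_def)
    with Suc ray_in_long_products[OF assms(3), of "Suc n" N] show ?case
      by (metis rtrancl_on_into_rtrancl_on)
  qed
  then show ?thesis by (intro rays_equivalentI[OF assms(1,2)]) blast
qed

lemma card_quotient_eq_1_iff:
  assumes "\<And>x. x \<in> A \<Longrightarrow> (x, x) \<in> R" "R \<subseteq> A \<times> A"
  shows "card (A // R) = 1 \<longleftrightarrow> A \<noteq> {} \<and> R = A \<times> A"
proof
  assume "card (A // R) = 1"
  then obtain X where X: "A // R = {X}" by (rule card_1_singletonE)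
  \<comment> \<open>The single class is the image of every \<open>x\<close>; reflexivity puts each
    \<open>y\<close> into its own image, hence into that of \<open>x\<close>.\<close>
  then have "R `` {x} = X" if "x \<in> A" for x
    using quotientI[OF that, of R] by simp
  then have R: "(x, y) \<in> R" if "x \<in> A" "y \<in> A" for x y
    using that assms(1)[of y] by blast
  have "A \<noteq> {}" using X by auto
  with R assms(2) show "A \<noteq> {} \<and> R = A \<times> A" by blast
next
  assume "A \<noteq> {} \<and> R = A \<times> A"
  then have "A // R = {A}" by (auto simp: quotient_def)
  then show "card (A // R) = 1" by simp
qed

lemma card_ends_eq_1_iff:
  assumes "iterated_function_system F" "\<not> (\<exists>u \<in> generated_semigroup F. idempotent u)"
  shows "card (ends F) = 1 \<longleftrightarrow> (\<forall>r r'. is_ray F r \<longrightarrow> is_ray F r' \<longrightarrow> rays_equivalent F r r')"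
proof -
  obtain f where "f \<in> F" using assms(1) by (auto simp: iterated_function_system_def)
  then have "is_ray F (prefix_composition (\<lambda>_. f))"
    by (intro is_ray_prefix_composition assms)
  then have ne: "Collect (is_ray F) \<noteq> {}" by blast
  show ?thesis
    unfolding ends_def
    by (subst card_quotient_eq_1_iff) (use ne rays_equivalent_refl[OF assms] in auto)
qed

section \<open>First letters along undirected paths\<close>

lemma reachable_first_letters:
  fixes F :: "('a \<Rightarrow> 'a) set"
  assumes "(s, t) \<in> rtrancl_on (generated_semigroup F) (cayley_adjacency F)"
    and "f \<in> F" "s = f \<or> (\<exists>u \<in> generated_semigroup F. s = f \<circ> u)"
    and "g \<in> F" "t = g \<or> (\<exists>u \<in> generated_semigroup F. t = g \<circ> u)"
  shows "(f, g) \<in> rtrancl_on F {(f, g). linked F f g}"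
proof -
  \<comment> \<open>The case \<open>s = f\<close> is listed separately because the remainder
    \<open>u\<close> has to be a nonempty product.\<close>
  define starts :: "('a \<Rightarrow> 'a) \<Rightarrow> ('a \<Rightarrow> 'a) \<Rightarrow> bool"
    where "starts f s \<longleftrightarrow> s = f \<or> (\<exists>u \<in> generated_semigroup F. s = f \<circ> u)" for f s
  have starts_comp: "\<exists>u \<in> generated_semigroup F. s \<circ> h = f \<circ> u" if "starts f s" "h \<in> F" for f s h
  proof -
    consider "s = f" | u where "u \<in> generated_semigroup F" "s = f \<circ> u"
      using \<open>starts f s\<close> unfolding starts_def by blast
    then show ?thesis
    proof cases
      case 1
      then show ?thesis using generated_semigroup.generator[OF \<open>h \<in> F\<close>] by blast
    next
      case 2
      then show ?thesis
        using generated_semigroup.composition[OF _ generated_semigroup.generator[OF \<open>h \<in> F\<close>]]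
        by (metis comp_assoc)
    qed
  qed
  \<comment> \<open>Linking demands remainders in the semigroup, so a generator, here the
    \<open>f\<close> of the lemma, is first appended to \<open>s\<close>; this covers the case that
    \<open>s\<close> is itself \<open>f\<close> or \<open>g\<close>.\<close>
  have starts_linked: "linked F f g" if "starts f s" "starts g s" for f g s
    using starts_comp[OF that(1) assms(2)] starts_comp[OF that(2) assms(2)]
    unfolding linked_def by metis
  have ex_start: "\<exists>f\<in>F. starts f s" if "s \<in> generated_semigroup F" for s
    using that
  proof induction
    case (composition s t)
    then show ?case unfolding starts_def by (metis comp_assoc generated_semigroup.composition)
  qed (auto simp: starts_def)
  \<comment> \<open>A vertex may have several first letters, so the invariant speaks of all of
    them.\<close>
  have "\<forall>g\<in>F. starts g t \<longrightarrow> (f, g) \<in> rtrancl_on F {(f, g). linked F f g}"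
    using assms(1)
  proof (induction rule: rtrancl_on_induct)
    case base
    then show ?case
      using assms(2,3) starts_linked rtrancl_on_into_rtrancl_on[of f f F]
      by (auto simp: starts_def)
  next
    case (step y z)
    show ?case
    proof (intro ballI impI)
      fix g assume g: "g \<in> F" "starts g z"
      obtain h where h: "h \<in> F" "starts h y" using ex_start step by blast
      obtain k where "k \<in> F" "z = y \<circ> k \<or> y = z \<circ> k"
        using step by (auto simp: cayley_adjacency_def)
      \<comment> \<open>First letters survive right multiplication: \<open>h\<close> starts
        \<open>z\<close> if \<open>z = y \<circ> k\<close>, and \<open>g\<close> starts
        \<open>y\<close> if \<open>y = z \<circ> k\<close>. Either way \<open>h\<close> and
        \<open>g\<close> start a common vertex.\<close>
      then have "linked F h g"
        using starts_linked starts_comp g h unfolding starts_def by metis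
      with step.IH h g show "(f, g) \<in> rtrancl_on F {(f, g). linked F f g}"
        by (auto intro: rtrancl_on_into_rtrancl_on)
    qed
  qed
  with assms(4,5) show ?thesis unfolding starts_def by blast
qed

theorem theorem13:
  fixes F :: "('a::complete_space \<Rightarrow> 'a) set"
  assumes "iterated_function_system F"
    and "\<not> (\<exists>u \<in> generated_semigroup F. idempotent u)"
  shows "Digraph_Component.connected (with_proj (link_graph F)) \<longleftrightarrow> card (ends F) = 1"
  unfolding connected_link_graph_iff card_ends_eq_1_iff[OF assms]
proof
  assume conn: "F \<noteq> {} \<and> (\<forall>f\<in>F. \<forall>g\<in>F. (f, g) \<in> rtrancl_on F {(f, g). linked F f g})"
  show "\<forall>r r'. is_ray F r \<longrightarrow> is_ray F r' \<longrightarrow> rays_equivalent F r r'"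
  proof (intro allI impI)
    fix r r' assume rays: "is_ray F r" "is_ray F r'"
    show "rays_equivalent F r r'"
    proof (intro rays_equivalentI[OF assms] exI allI)
      fix N n
      \<comment> \<open>The vertex \<open>r N\<close> serves as base point for both tails, written
        \<open>0 + N\<close> to fit \<open>ray_in_long_products\<close>.\<close>
      show "(r (0 + N), r (n + N)) \<in> rtrancl_on (long_products F N) (cayley_adjacency F) \<and>
          (r (0 + N), r' (n + N)) \<in> rtrancl_on (long_products F N) (cayley_adjacency F)"
        using conn by (intro conjI long_products_connected ray_in_long_products rays) auto
    qed
  qed
next
  assume equiv: "\<forall>r r'. is_ray F r \<longrightarrow> is_ray F r' \<longrightarrow> rays_equivalent F r r'"
  have "(f, g) \<in> rtrancl_on F {(f, g). linked F f g}" if fg: "f \<in> F" "g \<in> F" for f g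
  proof -
    \<comment> \<open>The powers of a generator form a ray all of whose vertices start with that
      generator; \<open>pow h n\<close> has \<open>n + 1\<close> factors.\<close>
    define pow :: "('a \<Rightarrow> 'a) \<Rightarrow> nat \<Rightarrow> 'a \<Rightarrow> 'a" where "pow h = prefix_composition (\<lambda>_. h)" for h
    have "is_ray F (pow h)" if "h \<in> F" for h
      unfolding pow_def using that by (intro is_ray_prefix_composition assms)
    with equiv fg have "rays_equivalent F (pow f) (pow g)" by blast
    \<comment> \<open>Deleting the empty set yields a component of the whole Cayley graph that meets
      both rays.\<close>
    then obtain C and \<sigma> \<tau> :: "nat \<Rightarrow> nat" where "C \<in> path_components (delete_vertices (cayley_graph F) {})"
        "\<forall>n. pow f (\<sigma> n) \<in> C \<and> pow g (\<tau> n) \<in> C"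
      unfolding rays_equivalent_def by blast
    then have reach: "(pow f (\<sigma> 0), pow g (\<tau> 0)) \<in> rtrancl_on (generated_semigroup F) (cayley_adjacency F)"
      using path_componentD by fastforce
    have "pow h n = h \<or> (\<exists>u \<in> generated_semigroup F. pow h n = h \<circ> u)" if "h \<in> F" for h n
      \<comment> \<open>For positive \<open>n\<close> the index \<open>Suc (0 + (n - 1))\<close>
        equals \<open>n\<close>; for \<open>n = 0\<close> the power is \<open>h\<close>
        itself.\<close>
      using prefix_composition_factor[of "\<lambda>_. h" F 0 "n - 1"] that
      by (cases n) (auto simp: pow_def)
    with reach fg show ?thesis
      by (intro reachable_first_letters[of "pow f (\<sigma> 0)" "pow g (\<tau> 0)"])
  qed
  then show "F \<noteq> {} \<and> (\<forall>f\<in>F. \<forall>g\<in>F. (f, g) \<in> rtrancl_on F {(f, g). linked F f g})"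
    using assms(1) by (auto simp: iterated_function_system_def)
qed

end
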